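(* Let $c_{2,0},c_{1,0},c_{1,1},c_{0,0},c_{0,1},c_{0,2}\in\mathbb R$ and $$L_2=c_{2,0}D^2+(c_{1,0}+c_{1,1}x)D+(c_{0,0}+c_{0,1}x+c_{0,2}x^2),$$ with Heat--Airy transport $N_2=P_{t,s}L_2P_{t,s}^{-1}=\sum_{k=0}^4q_k(x,t,s)D^k$. Let $I\subset\mathbb R^2$ be open, $f:I\to\mathbb R$ smooth, and $v$ smooth on $I\times\mathbb R$ with $v_t=\frac12v_{xx}$, $v_s=-\frac13v_{xxx}$, $N_2v=0$ and $v(t,s,f(t,s))=0$ on $I$. Then at $x=f(t,s)$ the boundary jet $V_2=(v^{(4)},v^{(3)},v^{(2)},v^{(1)})^{\mathsf T}$ satisfies $M_2(f;t,s)V_2=0$, where $$M_2(f;t,s)=\begin{pmatrix}q_4&q_3&q_2&q_1\\0&0&1&2f_t\\0&1&0&-3f_s\\1&4f_t&4f_t^2&4f_{tt}\end{pmatrix}_{x=f(t,s)} .$$ Hence at every $(t,s)\in I$ where $V_2\neq0$ one has $\det M_2(f;t,s)=0$, and this condition is equivalent to $$q_1(f,t,s)-2f_tq_2(f,t,s)+3f_sq_3(f,t,s)+\left[-4f_{tt}+8(f_t)^3-12f_tf_s\right]q_4(f,t,s)=0 .$$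
   Context: $D=\partial/\partial x$, $v^{(k)}=\partial_x^kv$, and $P_{t,s}=\exp(\frac t2D^2-\frac s3D^3)$. Conjugation by $P_{t,s}$ fixes $D$ and sends multiplication by $x$ to $x+tD-sD^2$. The resulting coefficients of $N_2$ are $q_0=c_{0,0}+c_{0,1}x+c_{0,2}(x^2+t)$, $q_1=c_{1,0}+c_{1,1}x+c_{0,1}t+c_{0,2}(2tx-2s)$, $q_2=c_{2,0}+c_{1,1}t-c_{0,1}s+c_{0,2}(t^2-2sx)$, $q_3=-c_{1,1}s-2c_{0,2}ts$, $q_4=c_{0,2}s^2$. *)

theory Defs
  imports "HOL-Analysis.Analysis" "HOL-Computational_Algebra.Polynomial"
begin

text \<open>C-infinity functions on an open subset of a normed space: all iterated directional
  derivatives exist as Frechet derivatives and are continuous.\<close>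

primrec Ck_on :: "nat \<Rightarrow> 'a::real_normed_vector set \<Rightarrow> ('a \<Rightarrow> 'b::real_normed_vector) \<Rightarrow> bool" where
  "Ck_on 0 S g \<longleftrightarrow> continuous_on S g"
| "Ck_on (Suc k) S g \<longleftrightarrow>
     (\<forall>x\<in>S. g differentiable (at x)) \<and> (\<forall>h. Ck_on k S (\<lambda>x. frechet_derivative g (at x) h))"

definition smooth_on :: "'a::real_normed_vector set \<Rightarrow> ('a \<Rightarrow> 'b::real_normed_vector) \<Rightarrow> bool" where
  "smooth_on S g \<longleftrightarrow> (\<forall>k. Ck_on k S g)"

text \<open>Points of the time plane are pairs \<open>(t, s)\<close>; a function of \<open>(t, s, x)\<close> takes the
  argument \<open>((t, s), x)\<close>.\<close>

definition Dt :: "(real \<times> real \<Rightarrow> real) \<Rightarrow> real \<times> real \<Rightarrow> real" where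
  "Dt g p = deriv (\<lambda>\<tau>. g (\<tau>, snd p)) (fst p)"

definition Ds :: "(real \<times> real \<Rightarrow> real) \<Rightarrow> real \<times> real \<Rightarrow> real" where
  "Ds g p = deriv (\<lambda>\<sigma>. g (fst p, \<sigma>)) (snd p)"

definition Dx :: "nat \<Rightarrow> ((real \<times> real) \<times> real \<Rightarrow> real) \<Rightarrow> real \<times> real \<Rightarrow> real \<Rightarrow> real" where
  "Dx k v p x = (deriv ^^ k) (\<lambda>\<xi>. v (p, \<xi>)) x"

text \<open>The operator \<open>P\<^sub>t\<^sub>,\<^sub>s = exp (t/2 D\<^sup>2 - s/3 D\<^sup>3)\<close> is realised on real polynomials in \<open>x\<close>.
  There the exponential series terminates: the exponent lowers the degree by at least 2, so its
  powers beyond \<open>degree p\<close> annihilate \<open>p\<close>. A differential operator with polynomial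
  coefficients is determined by its action on polynomials, so this fixes the operator
  \<open>P L P\<inverse>\<close> completely.\<close>

definition heat_airy_exponent :: "real \<Rightarrow> real \<Rightarrow> real poly \<Rightarrow> real poly" where
  "heat_airy_exponent t s p =
     smult (t / 2) ((pderiv ^^ 2) p) - smult (s / 3) ((pderiv ^^ 3) p)"

definition heat_airy :: "real \<Rightarrow> real \<Rightarrow> real poly \<Rightarrow> real poly" where
  "heat_airy t s p = (\<Sum>n\<le>degree p. smult (1 / fact n) ((heat_airy_exponent t s ^^ n) p))"

text \<open>\<open>c j i\<close> is the coefficient of \<open>x\<^sup>i D\<^sup>j\<close>; only the six entries displayed below are used.\<close>

definition L2 :: "(nat \<Rightarrow> nat \<Rightarrow> real) \<Rightarrow> real poly \<Rightarrow> real poly" where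
  "L2 c p = [:c 2 0:] * (pderiv ^^ 2) p + [:c 1 0, c 1 1:] * pderiv p
     + [:c 0 0, c 0 1, c 0 2:] * p"

definition q :: "(nat \<Rightarrow> nat \<Rightarrow> real) \<Rightarrow> nat \<Rightarrow> real \<Rightarrow> real \<Rightarrow> real \<Rightarrow> real" where
  "q c k x t s =
     [c 0 0 + c 0 1 * x + c 0 2 * (x\<^sup>2 + t),
      c 1 0 + c 1 1 * x + c 0 1 * t + c 0 2 * (2 * t * x - 2 * s),
      c 2 0 + c 1 1 * t - c 0 1 * s + c 0 2 * (t\<^sup>2 - 2 * s * x),
      - c 1 1 * s - 2 * c 0 2 * t * s,
      c 0 2 * s\<^sup>2] ! k"

definition N2 ::
  "(nat \<Rightarrow> nat \<Rightarrow> real) \<Rightarrow> real \<Rightarrow> real \<Rightarrow> (real \<Rightarrow> real) \<Rightarrow> real \<Rightarrow> real" where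
  "N2 c t s g x = (\<Sum>k\<le>4. q c k x t s * (deriv ^^ k) g x)"

definition V2 :: "((real \<times> real) \<times> real \<Rightarrow> real) \<Rightarrow> real \<times> real \<Rightarrow> real \<Rightarrow> real ^ 4" where
  "V2 v p x = vector [Dx 4 v p x, Dx 3 v p x, Dx 2 v p x, Dx 1 v p x]"

definition M2 ::
  "(nat \<Rightarrow> nat \<Rightarrow> real) \<Rightarrow> (real \<times> real \<Rightarrow> real) \<Rightarrow> real \<Rightarrow> real \<Rightarrow> real ^ 4 ^ 4" where
  "M2 c f t s = (let x = f (t, s); ft = Dt f (t, s); fs = Ds f (t, s); ftt = Dt (Dt f) (t, s) in
     vector [vector [q c 4 x t s, q c 3 x t s, q c 2 x t s, q c 1 x t s],
             vector [0, 0, 1, 2 * ft],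
             vector [0, 1, 0, - 3 * fs],
             vector [1, 4 * ft, 4 * ft\<^sup>2, 4 * ftt]])"

end

theory Submission imports Defs begin

text \<open>On polynomials, \<open>P\<^sub>t\<^sub>,\<^sub>s\<close> commutes with \<open>D\<close> and turns multiplication by \<open>x\<close> into
  \<open>x + t D - s D\<^sup>2\<close>; these two rules yield both its inverse \<open>P\<^sub>-\<^sub>t\<^sub>,\<^sub>-\<^sub>s\<close> and the coefficients of the
  transported operator. The rows of \<open>M2\<close> come from restricting \<open>N\<^sub>2 v = 0\<close> to \<open>x = f\<close> and from
  differentiating \<open>v(t, s, f(t, s)) = 0\<close> once in \<open>t\<close>, once in \<open>s\<close> and twice in \<open>t\<close>, replacing
  time derivatives of \<open>v\<close> by spatial ones. The determinant vanishes iff \<open>M2\<close> has a nonzero kernel vector, and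
  the last three rows determine such a vector up to scale.\<close>

subsection \<open>Heat--Airy conjugation of polynomial operators\<close>

lemma heat_airy_exponent_pderivs:
  "heat_airy_exponent t s p = smult (t / 2) (pderiv (pderiv p)) - smult (s / 3) (pderiv (pderiv (pderiv p)))"
  by (simp add: heat_airy_exponent_def numeral_2_eq_2 numeral_3_eq_3)

lemma heat_airy_exponent_funpow_add:
  "(heat_airy_exponent t s ^^ n) (p + r) = (heat_airy_exponent t s ^^ n) p + (heat_airy_exponent t s ^^ n) r"
  by (induction n) (simp_all add: heat_airy_exponent_pderivs pderiv_add smult_add_right)

lemma heat_airy_exponent_funpow_smult:
  "(heat_airy_exponent t s ^^ n) (smult a p) = smult a ((heat_airy_exponent t s ^^ n) p)"
  by (induction n) (simp_all add: heat_airy_exponent_pderivs pderiv_smult smult_diff_right mult.commute)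

lemma heat_airy_exponent_funpow_pderiv:
  "(heat_airy_exponent t s ^^ n) (pderiv p) = pderiv ((heat_airy_exponent t s ^^ n) p)"
  by (induction n) (simp_all add: heat_airy_exponent_pderivs pderiv_smult pderiv_diff)

text \<open>Every application lowers the degree by at least one until a constant is reached, and
  constants are annihilated. This weak bound already justifies the cut-off in
  \<open>heat_airy\<close>.\<close>

lemma heat_airy_exponent_funpow_eq_0:
  "degree p < n \<Longrightarrow> (heat_airy_exponent t s ^^ n) p = 0"
proof (induction n arbitrary: p)
  case (Suc n)
  have 0: "(heat_airy_exponent t s ^^ n) 0 = 0"
    using heat_airy_exponent_funpow_smult[of n t s 0 0] by simp
  show ?case
  \<comment> \<open>Truncated subtraction gives \<open>degree p - 1 = 0\<close> for constants, which
    need not be below \<open>n\<close>; hence the separate case.\<close>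
  proof (cases "degree p = 0")
    case True
    then have "pderiv p = 0" by (simp add: pderiv_eq_0_iff)
    then have "heat_airy_exponent t s p = 0" by (simp add: heat_airy_exponent_pderivs)
    then show ?thesis using 0 by (simp add: funpow_swap1)
  next
    case False
    have "degree (heat_airy_exponent t s p) \<le> degree p - 1"
      unfolding heat_airy_exponent_pderivs
      by (intro degree_diff_le order.trans[OF degree_smult_le]) (simp_all add: degree_pderiv)
    then have "degree (heat_airy_exponent t s p) < n" using False Suc.prems by linarith
    then show ?thesis using Suc.IH by (simp add: funpow_swap1)
  qed
qed simp

text \<open>The cut-off in \<open>heat_airy\<close> varies with the polynomial. Padding with zero
  terms gives several polynomials a common cut-off, so that their series can be compared
  termwise.\<close>

lemma heat_airy_eq_sum:
  assumes "degree p \<le> N"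
  shows "heat_airy t s p = (\<Sum>n\<le>N. smult (1 / fact n) ((heat_airy_exponent t s ^^ n) p))"
  unfolding heat_airy_def
  by (rule sum.mono_neutral_left) (use assms in \<open>auto simp: heat_airy_exponent_funpow_eq_0\<close>)

lemma heat_airy_add: "heat_airy t s (p + r) = heat_airy t s p + heat_airy t s r"
proof -
  define N where "N = max (degree p) (degree r)"
  have "degree p \<le> N" "degree r \<le> N" "degree (p + r) \<le> N"
    by (auto simp: N_def degree_add_le_max)
  then show ?thesis
    by (simp add: heat_airy_eq_sum[of _ N] heat_airy_exponent_funpow_add smult_add_right sum.distrib)
qed

lemma smult_sum_right: "smult a (sum f S) = (\<Sum>x\<in>S. smult a (f x))"
  by (induction S rule: infinite_finite_induct) (simp_all add: smult_add_right)

lemma heat_airy_smult: "heat_airy t s (smult a p) = smult a (heat_airy t s p)"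
  by (simp add: heat_airy_eq_sum[of _ "degree p"] heat_airy_exponent_funpow_smult 
      smult_sum_right mult.commute)

lemma heat_airy_diff: "heat_airy t s (p - r) = heat_airy t s p - heat_airy t s r"
  using heat_airy_add[of t s "p - r" r] by simp

lemma pderiv_sum: "pderiv (sum f S) = (\<Sum>x\<in>S. pderiv (f x))"
  by (induction S rule: infinite_finite_induct) (simp_all add: pderiv_add)

lemma heat_airy_pderiv: "heat_airy t s (pderiv p) = pderiv (heat_airy t s p)"
  by (simp add: heat_airy_eq_sum[of _ "degree p"] degree_pderiv heat_airy_exponent_funpow_pderiv
      pderiv_sum pderiv_smult)

section \<open>Commutation with multiplication by x\<close>

definition X_shift :: "real \<Rightarrow> real \<Rightarrow> real poly \<Rightarrow> real poly" where
  "X_shift t s p = smult t (pderiv p) - smult s (pderiv (pderiv p))"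

text \<open>\<open>pCons 0\<close> is multiplication by x. Since the commutator of D^k with x is k
  D^(k-1), the commutator of the exponent with x is t D - s D^2, which is
  \<open>X_shift\<close>.\<close>

lemma heat_airy_exponent_X:
  "heat_airy_exponent t s (pCons 0 p) = pCons 0 (heat_airy_exponent t s p) + X_shift t s p"
proof (rule poly_eqI)
  fix n
  show "coeff (heat_airy_exponent t s (pCons 0 p)) n =
      coeff (pCons 0 (heat_airy_exponent t s p) + X_shift t s p) n"
    by (cases n) (simp_all add: heat_airy_exponent_pderivs X_shift_def coeff_pderiv algebra_simps)
qed

text \<open>Both operators are polynomials in D with constant coefficients, so they commute.\<close>

lemma heat_airy_exponent_X_shift:
  "(heat_airy_exponent t s ^^ n) (X_shift t s p) = X_shift t s ((heat_airy_exponent t s ^^ n) p)"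
proof -
  have "(heat_airy_exponent t s ^^ n) (a - b) = (heat_airy_exponent t s ^^ n) a - (heat_airy_exponent t s ^^ n) b" for a b
    using heat_airy_exponent_funpow_add[of n t s "a - b" b] by simp
  then show ?thesis
    by (simp add: X_shift_def heat_airy_exponent_funpow_smult heat_airy_exponent_funpow_pderiv)
qed

text \<open>As the commutator \<open>X_shift\<close> itself commutes with the exponent E, moving x
  past n + 1 factors E yields n + 1 equal corrections.\<close>

lemma heat_airy_exponent_funpow_X:
  "(heat_airy_exponent t s ^^ Suc n) (pCons 0 p) =
     pCons 0 ((heat_airy_exponent t s ^^ Suc n) p) +
     smult (of_nat (Suc n)) (X_shift t s ((heat_airy_exponent t s ^^ n) p))"
proof (induction n)
  case 0
  then show ?case by (simp add: heat_airy_exponent_X)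
next
  case (Suc n)
  have add: "heat_airy_exponent t s (a + b) = heat_airy_exponent t s a + heat_airy_exponent t s b" for a b
    using heat_airy_exponent_funpow_add[of 1 t s a b] by simp
  have smult: "heat_airy_exponent t s (smult a b) = smult a (heat_airy_exponent t s b)" for a b
    using heat_airy_exponent_funpow_smult[of 1 t s a b] by simp
  have shift: "heat_airy_exponent t s (X_shift t s a) = X_shift t s (heat_airy_exponent t s a)" for a
    using heat_airy_exponent_X_shift[of 1 t s a] by simp
  have "(heat_airy_exponent t s ^^ Suc (Suc n)) (pCons 0 p) =
    heat_airy_exponent t s ((heat_airy_exponent t s ^^ Suc n) (pCons 0 p))" by simp
  also have "\<dots> = heat_airy_exponent t s (pCons 0 ((heat_airy_exponent t s ^^ Suc n) p) +
     smult (of_nat (Suc n)) (X_shift t s ((heat_airy_exponent t s ^^ n) p)))"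
    by (simp only: Suc.IH)
  also have "\<dots> = pCons 0 ((heat_airy_exponent t s ^^ Suc (Suc n)) p) +
     smult (of_nat (Suc (Suc n))) (X_shift t s ((heat_airy_exponent t s ^^ Suc n) p))"
    by (simp add: add smult shift heat_airy_exponent_X of_nat_Suc[of "Suc n"] smult_add_left
        del: of_nat_Suc)
  finally show ?case .
qed

lemma X_shift_smult: "X_shift t s (smult a p) = smult a (X_shift t s p)"
  by (simp add: X_shift_def pderiv_smult smult_diff_right mult.commute)

lemma X_shift_sum: "X_shift t s (sum f S) = (\<Sum>x\<in>S. X_shift t s (f x))"
  by (simp add: X_shift_def pderiv_sum smult_sum_right sum_subtractf)

lemma pCons_0_sum: "pCons 0 (sum f S) = (\<Sum>x\<in>S. pCons 0 (f x))"
  for f :: "'b \<Rightarrow> 'a::comm_ring_1 poly"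
  using sum_distrib_left[of "[:0, 1:]" f S] by simp

text \<open>The factor n + 1 from the commutator turns 1/(n+1)! into 1/n!, so the corrections sum to
  \<open>X_shift\<close> of the exponential series again.\<close>

lemma heat_airy_X: "heat_airy t s (pCons 0 p) = pCons 0 (heat_airy t s p) + X_shift t s (heat_airy t s p)"
proof -
  define N where "N = degree p"
  define E where "E = heat_airy_exponent t s"
  have step: "smult (1 / fact (Suc n)) ((E ^^ Suc n) (pCons 0 p)) =
     pCons 0 (smult (1 / fact (Suc n)) ((E ^^ Suc n) p)) + X_shift t s (smult (1 / fact n) ((E ^^ n) p))" for n
  proof -
    have "1 / fact (Suc n) * real (Suc n) = 1 / fact n"
      by (simp add: field_simps del: of_nat_Suc)
    then show ?thesis
      unfolding E_def heat_airy_exponent_funpow_X by (simp add: X_shift_smult smult_add_right del: of_nat_Suc fact_Suc)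
  qed
  \<comment> \<open>Multiplication by x can raise the degree to \<open>Suc N\<close>. After the
    index shift the corrections run up to \<open>N\<close>, which still covers the whole series of
    \<open>p\<close>.\<close>
  have "heat_airy t s (pCons 0 p) = (\<Sum>n\<le>Suc N. smult (1 / fact n) ((E ^^ n) (pCons 0 p)))"
    unfolding E_def by (rule heat_airy_eq_sum) (simp add: N_def degree_pCons_le)
  also have "\<dots> = pCons 0 p + (\<Sum>n\<le>N. smult (1 / fact (Suc n)) ((E ^^ Suc n) (pCons 0 p)))"
    by (subst sum.atMost_Suc_shift) simp
  also have "\<dots> = pCons 0 (\<Sum>n\<le>Suc N. smult (1 / fact n) ((E ^^ n) p)) +
      X_shift t s (\<Sum>n\<le>N. smult (1 / fact n) ((E ^^ n) p))"
    unfolding step sum.distrib pCons_0_sum X_shift_sum by (simp add: sum.atMost_Suc_shift add.assoc del: funpow.simps(2) fact_Suc sum.atMost_Suc)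
  also have "(\<Sum>n\<le>Suc N. smult (1 / fact n) ((E ^^ n) p)) = heat_airy t s p"
    unfolding E_def by (rule heat_airy_eq_sum[symmetric]) (simp add: N_def)
  also have "(\<Sum>n\<le>N. smult (1 / fact n) ((E ^^ n) p)) = heat_airy t s p"
    unfolding E_def by (rule heat_airy_eq_sum[symmetric]) (simp add: N_def)
  finally show ?thesis .
qed

section \<open>The inverse of the transport and the conjugated operator\<close>

lemma heat_airy_const: "heat_airy t s [:a:] = [:a:]"
  by (simp add: heat_airy_def)

lemma heat_airy_pCons:
  "heat_airy t s (pCons a p) = [:a:] + pCons 0 (heat_airy t s p) + X_shift t s (heat_airy t s p)"
  using heat_airy_add[of t s "[:a:]" "pCons 0 p"] by (simp add: heat_airy_const heat_airy_X)

text \<open>Moving the outer operator past x produces \<open>X_shift (- t) (- s)\<close>, which is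
  the negative of \<open>X_shift t s\<close>; the two corrections cancel in the induction over
  coefficients.\<close>

lemma heat_airy_inverse: "heat_airy (- t) (- s) (heat_airy t s p) = p"
proof (induction p)
  case 0
  then show ?case by (simp add: heat_airy_def heat_airy_exponent_pderivs)
next
  case (pCons a p)
  have "heat_airy (- t) (- s) (X_shift t s r) = - X_shift (- t) (- s) (heat_airy (- t) (- s) r)" for r
    by (simp add: X_shift_def heat_airy_diff heat_airy_smult heat_airy_pderiv)
  with pCons.IH show ?case
    by (simp add: heat_airy_pCons[of t s] heat_airy_add heat_airy_pCons[of "- t" "- s"])
qed

lemma bij_heat_airy: "bij (heat_airy t s)"
  by (rule o_bij[of "heat_airy (- t) (- s)"])
    (use heat_airy_inverse[of "- t" "- s"] in \<open>auto simp: fun_eq_iff heat_airy_inverse\<close>)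

lemma deriv_funpow_poly: "(deriv ^^ k) (poly p) = poly ((pderiv ^^ k) p)" for p :: "real poly"
proof (induction k)
  case (Suc k)
  have "deriv (poly r) = poly (pderiv r)" for r :: "real poly"
    by (rule ext) (simp add: DERIV_imp_deriv)
  with Suc show ?case by simp
qed simp

text \<open>The intertwining form P L = N P of the conjugation needs no inverse: P is pushed inwards
  by its rules for D and x, and the resulting coefficients are those in \<open>q\<close>.\<close>

lemma poly_heat_airy_L2: "poly (heat_airy t s (L2 c p)) = N2 c t s (poly (heat_airy t s p))"
proof
  fix x
  define r where "r = heat_airy t s p"
  \<comment> \<open>Powers of x are written as iterated \<open>pCons 0\<close>, so that
    \<open>heat_airy_X\<close> applies once per factor.\<close>
  have L2: "L2 c p = smult (c 2 0) (pderiv (pderiv p)) + smult (c 1 0) (pderiv p) +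
      smult (c 1 1) (pCons 0 (pderiv p)) + smult (c 0 0) p + smult (c 0 1) (pCons 0 p) +
      smult (c 0 2) (pCons 0 (pCons 0 p))"
    by (simp add: L2_def numeral_2_eq_2 algebra_simps)
  show "poly (heat_airy t s (L2 c p)) x = N2 c t s (poly (heat_airy t s p)) x"
    unfolding L2 heat_airy_add heat_airy_smult heat_airy_X heat_airy_pderiv r_def[symmetric]
      N2_def deriv_funpow_poly
    by (simp add: q_def eval_nat_numeral X_shift_def pderiv_add pderiv_diff pderiv_smult pderiv_pCons algebra_simps)
qed

lemma heat_airy_conj_L2:
  "poly ((heat_airy t s \<circ> L2 c \<circ> inv (heat_airy t s)) p) = N2 c t s (poly p)"
  using bij_heat_airy[of t s] by (simp add: poly_heat_airy_L2 surj_f_inv_f bij_is_surj)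

subsection \<open>The kernel of the boundary matrix\<close>

lemma vector_4:
  "(vector [x, y, z, w] :: ('a::zero)^4) $ 1 = x"
  "(vector [x, y, z, w] :: ('a::zero)^4) $ 2 = y"
  "(vector [x, y, z, w] :: ('a::zero)^4) $ 3 = z"
  "(vector [x, y, z, w] :: ('a::zero)^4) $ 4 = w"
  unfolding vector_def by simp_all

lemma det_eq_0_iff_kernel: "det A = 0 \<longleftrightarrow> (\<exists>x. x \<noteq> 0 \<and> A *v x = 0)" for A :: "real ^ 'n ^ 'n"
  using invertible_det_nz[of A] matrix_left_invertible_ker[of A] 
  by (auto simp: invertible_left_inverse)

lemma M2_kernel_iff:
  "M2 c f t s *v y = 0 \<longleftrightarrow>
    q c 4 (f (t, s)) t s * y $ 1 + q c 3 (f (t, s)) t s * y $ 2 +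
      q c 2 (f (t, s)) t s * y $ 3 + q c 1 (f (t, s)) t s * y $ 4 = 0 \<and>
    y $ 3 + 2 * Dt f (t, s) * y $ 4 = 0 \<and>
    y $ 2 - 3 * Ds f (t, s) * y $ 4 = 0 \<and>
    y $ 1 + 4 * Dt f (t, s) * y $ 2 + 4 * (Dt f (t, s))\<^sup>2 * y $ 3 + 4 * Dt (Dt f) (t, s) * y $ 4 = 0"
  by (simp add: vec_eq_iff forall_4 matrix_vector_mult_def sum_4 M2_def Let_def vector_4)

text \<open>Elimination replaces expanding the determinant: rows two to four express a kernel vector
  through its last entry, and row one then becomes that entry times the scalar expression.\<close>

lemma det_M2_eq_0_iff:
  "det (M2 c f t s) = 0 \<longleftrightarrow>
     q c 1 (f (t, s)) t s - 2 * Dt f (t, s) * q c 2 (f (t, s)) t s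
     + 3 * Ds f (t, s) * q c 3 (f (t, s)) t s
     + (- 4 * Dt (Dt f) (t, s) + 8 * (Dt f (t, s)) ^ 3
        - 12 * Dt f (t, s) * Ds f (t, s)) * q c 4 (f (t, s)) t s = 0" (is "_ \<longleftrightarrow> ?R = 0")
proof
  assume "det (M2 c f t s) = 0"
  then obtain y where y: "y \<noteq> 0" "M2 c f t s *v y = 0" by (auto simp: det_eq_0_iff_kernel)
  have 3: "y $ 3 = - 2 * Dt f (t, s) * y $ 4" and 2: "y $ 2 = 3 * Ds f (t, s) * y $ 4"
    using y(2) by (auto simp: M2_kernel_iff)
  have 1: "y $ 1 = (- 4 * Dt (Dt f) (t, s) + 8 * (Dt f (t, s)) ^ 3
        - 12 * Dt f (t, s) * Ds f (t, s)) * y $ 4"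
    using y(2) unfolding M2_kernel_iff 2 3 by (auto simp: algebra_simps power2_eq_square power3_eq_cube)
  have "?R * y $ 4 = 0"
    using y(2) unfolding M2_kernel_iff 1 2 3 by (auto simp: algebra_simps)
  \<comment> \<open>All other entries are multiples of this one, so its vanishing would force
    \<open>y = 0\<close>.\<close>
  moreover have "y $ 4 \<noteq> 0"
    using y(1) 1 2 3 by (auto simp: vec_eq_iff forall_4)
  ultimately show "?R = 0" by simp
next
  assume R: "?R = 0"
  \<comment> \<open>The solution of rows two to four by back substitution, normalised to last entry
    1.\<close>
  define y :: "real ^ 4" where "y = vector [- 4 * Dt (Dt f) (t, s) + 8 * (Dt f (t, s)) ^ 3
        - 12 * Dt f (t, s) * Ds f (t, s), 3 * Ds f (t, s), - 2 * Dt f (t, s), 1]"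
  have "y $ 4 \<noteq> 0" by (simp add: y_def vector_4)
  then have "y \<noteq> 0" by auto
  moreover have "M2 c f t s *v y = 0"
    unfolding M2_kernel_iff using R
    by (simp add: y_def vector_4 algebra_simps power2_eq_square power3_eq_cube)
  ultimately show "det (M2 c f t s) = 0" by (auto simp: det_eq_0_iff_kernel)
qed

subsection \<open>Derivatives along curves\<close>

text \<open>Derivatives at points of an open set depend only on values in that set, so agreement
  passes to all orders. This carries smoothness over to \<open>Dt\<close> and \<open>Dx\<close>,
  which are known to match directional derivatives only on the domain.\<close>

lemma Ck_on_cong:
  assumes "open S" "\<And>x. x \<in> S \<Longrightarrow> g x = h x" "Ck_on k S g"
  shows "Ck_on k S h"
  using assms(2,3)
proof (induction k arbitrary: g h)
  case 0
  then show ?case by (simp cong: continuous_on_cong)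
next
  case (Suc k)
  have deriv: "(h has_derivative frechet_derivative g (at x)) (at x)" if "x \<in> S" for x
    using Suc.prems that assms(1)
    by (auto intro: has_derivative_transform_within_open simp: frechet_derivative_works)
  then have eq: "frechet_derivative g (at x) = frechet_derivative h (at x)" if "x \<in> S" for x
    using that by (metis frechet_derivative_at)
  have "Ck_on k S (\<lambda>x. frechet_derivative h (at x) w)" for w
    by (rule Suc.IH[where g = "\<lambda>x. frechet_derivative g (at x) w"])
      (use Suc.prems eq in auto)
  moreover have "\<forall>x\<in>S. h differentiable (at x)"
    using deriv by (auto simp: differentiable_def)
  ultimately show ?case by simp
qed

lemma smooth_on_cong:
  "open S \<Longrightarrow> (\<And>x. x \<in> S \<Longrightarrow> g x = h x) \<Longrightarrow> smooth_on S g \<Longrightarrow> smooth_on S h"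
  unfolding smooth_on_def using Ck_on_cong by blast

lemma smooth_on_differentiable: "smooth_on S g \<Longrightarrow> x \<in> S \<Longrightarrow> g differentiable (at x)"
  unfolding smooth_on_def by (metis Ck_on.simps(2))

lemma smooth_on_frechet_derivative:
  "smooth_on S g \<Longrightarrow> smooth_on S (\<lambda>x. frechet_derivative g (at x) w)"
  unfolding smooth_on_def by (metis Ck_on.simps(2))

lemma smooth_on_continuous: "smooth_on S g \<Longrightarrow> continuous_on S g"
  unfolding smooth_on_def by (metis Ck_on.simps(1))

lemma has_real_derivative_along_curve:
  fixes g :: "'a::real_normed_vector \<Rightarrow> real"
  assumes "g differentiable (at (\<gamma> t))" "(\<gamma> has_vector_derivative w) (at t)"
  shows "((\<lambda>\<tau>. g (\<gamma> \<tau>)) has_real_derivative frechet_derivative g (at (\<gamma> t)) w) (at t)"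
proof -
  have g: "(g has_derivative frechet_derivative g (at (\<gamma> t))) (at (\<gamma> t))"
    using assms(1) by (simp add: frechet_derivative_works)
  have "((\<lambda>\<tau>. g (\<gamma> \<tau>)) has_derivative (\<lambda>h. frechet_derivative g (at (\<gamma> t)) (h *\<^sub>R w))) (at t)"
    using has_derivative_compose[OF assms(2)[unfolded has_vector_derivative_def] g] .
  then show ?thesis
    unfolding has_field_derivative_def
    by (rule has_derivative_eq_rhs) 
      (simp add: fun_eq_iff linear_cmul[OF has_derivative_linear[OF g]])
qed

lemma has_vector_derivative_Pair_const:
  assumes "(\<gamma> has_vector_derivative w) (at t within S)"
  shows "((\<lambda>\<tau>. (\<gamma> \<tau>, c)) has_vector_derivative (w, 0)) (at t within S)"
    and "((\<lambda>\<tau>. (c, \<gamma> \<tau>)) has_vector_derivative (0, w)) (at t within S)"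
  using has_derivative_Pair[OF assms[unfolded has_vector_derivative_def] has_derivative_const[of c]]
    has_derivative_Pair[OF has_derivative_const[of c] assms[unfolded has_vector_derivative_def]]
  by (simp_all add: has_vector_derivative_def)

lemmas has_vector_derivative_slice = has_vector_derivative_Pair_const[OF has_vector_derivative_id]

text \<open>The chain rule in terms of separately known partial derivatives \<open>A\<close> and
  \<open>B\<close>: uniqueness identifies them with the Frechet derivative on \<open>(w, 0)\<close>
  and \<open>(0, 1)\<close>, and linearity combines them.\<close>

lemma has_real_derivative_along_graph:
  fixes g :: "'a::real_normed_vector \<times> real \<Rightarrow> real"
  assumes g: "g differentiable (at (\<gamma> t, \<phi> t))" and \<gamma>: "(\<gamma> has_vector_derivative w) (at t)"
    and \<phi>: "(\<phi> has_real_derivative m) (at t)"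
    and A: "((\<lambda>\<tau>. g (\<gamma> \<tau>, \<phi> t)) has_real_derivative A) (at t)"
    and B: "((\<lambda>\<xi>. g (\<gamma> t, \<xi>)) has_real_derivative B) (at (\<phi> t))"
  shows "((\<lambda>\<tau>. g (\<gamma> \<tau>, \<phi> \<tau>)) has_real_derivative A + m * B) (at t)"
proof -
  let ?g' = "frechet_derivative g (at (\<gamma> t, \<phi> t))"
  have \<phi>': "(\<phi> has_vector_derivative m) (at t)"
    using \<phi> by (simp add: has_real_derivative_iff_has_vector_derivative)
  have lin: "linear ?g'"
    using g by (rule linear_frechet_derivative)
  have "((\<lambda>\<tau>. g (\<gamma> \<tau>, \<phi> t)) has_real_derivative ?g' (w, 0)) (at t)"
    by (rule has_real_derivative_along_curve[OF g has_vector_derivative_Pair_const(1)[OF \<gamma>]])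
  then have A': "A = ?g' (w, 0)" using A DERIV_unique by blast
  have "((\<lambda>\<xi>. g (\<gamma> t, \<xi>)) has_real_derivative ?g' (0, 1)) (at (\<phi> t))"
    by (rule has_real_derivative_along_curve[OF g has_vector_derivative_slice(2)])
  then have B': "B = ?g' (0, 1)" using B DERIV_unique by blast
  have "(w, m) = (w, 0) + m *\<^sub>R (0, 1)" by simp
  then have "?g' (w, m) = A + m * B"
    unfolding A' B' by (simp only: linear_add[OF lin] linear_cmul[OF lin] real_scaleR_def)
  then show ?thesis
    using has_real_derivative_along_curve[of g "\<lambda>\<tau>. (\<gamma> \<tau>, \<phi> \<tau>)", OF g has_vector_derivative_Pair[OF \<gamma> \<phi>']]
    by simp
qed

text \<open>Clairaut's theorem without assuming that the mixed derivative in the other order exists: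
  integrate \<open>G\<close> in time, differentiate the integral in space, and differentiate back in time.\<close>

lemma mixed_partial_derivative:
  fixes F G H K :: "real \<Rightarrow> real \<Rightarrow> real"
  assumes t: "t \<in> {a<..<b}"
    and F_t: "\<And>\<tau> y. \<tau> \<in> {a<..<b} \<Longrightarrow> ((\<lambda>\<tau>. F \<tau> y) has_real_derivative G \<tau> y) (at \<tau>)"
    and F_x: "\<And>\<tau> y. \<tau> \<in> {a<..<b} \<Longrightarrow> (F \<tau> has_real_derivative H \<tau> y) (at y)"
    and G_x: "\<And>\<tau> y. \<tau> \<in> {a<..<b} \<Longrightarrow> (G \<tau> has_real_derivative K \<tau> y) (at y)"
    and K: "continuous_on ({a<..<b} \<times> UNIV) (\<lambda>(\<tau>, y). K \<tau> y)"
  shows "((\<lambda>\<tau>. H \<tau> x) has_real_derivative K t x) (at t)"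
proof -
  \<comment> \<open>The compact interval allows integration from \<open>c\<close>; as
    \<open>t\<close> is interior to it, the derivative within the interval is a full
    derivative.\<close>
  obtain c d where cd: "a < c" "c < t" "t < d" "d < b"
    using t dense by (metis greaterThanLessThan_iff)
  have H_eq: "H r x = H c x + integral {c..r} (\<lambda>\<tau>. K \<tau> x)" if r: "r \<in> {c..d}" for r
  proof -
    have FTC: "((\<lambda>\<tau>. G \<tau> y) has_integral F r y - F c y) {c..r}" for y
    proof (rule fundamental_theorem_of_calculus)
      fix \<tau> assume "\<tau> \<in> {c..r}"
      then have "\<tau> \<in> {a<..<b}" using r cd by auto
      from F_t[OF this, of y] show "((\<lambda>\<tau>. F \<tau> y) has_vector_derivative G \<tau> y) (at \<tau> within {c..r})"
        using has_field_derivative_at_within has_real_derivative_iff_has_vector_derivative by blast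
    qed (use r in auto)
    \<comment> \<open>The integral of \<open>G\<close> equals \<open>F r y - F c y\<close>.
      Differentiating both sides in \<open>y\<close>, on the left under the integral sign, gives the
      formula for \<open>H\<close>.\<close>
    have "((\<lambda>y. integral (cbox c r) (\<lambda>\<tau>. G \<tau> y)) has_real_derivative
        integral (cbox c r) (\<lambda>\<tau>. K \<tau> x)) (at x within UNIV)"
    proof (rule leibniz_rule_field_derivative)
      show "continuous_on (UNIV \<times> cbox c r) (\<lambda>(y, \<tau>). K \<tau> y)"
      proof -
        have "continuous_on (UNIV \<times> cbox c r) (\<lambda>z. (snd z, fst z))"
          by (intro continuous_intros)
        moreover have "(\<lambda>z. (snd z, fst z)) ` (UNIV \<times> cbox c r) \<subseteq> {a<..<b} \<times> UNIV"
          using r cd by auto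
        ultimately show ?thesis
          using continuous_on_compose2[OF K, of "UNIV \<times> cbox c r" "\<lambda>z. (snd z, fst z)"]
          by (simp add: case_prod_unfold)
      qed
      show "(\<lambda>\<tau>. G \<tau> y) integrable_on cbox c r" for y
        using FTC[of y] by (auto simp: integrable_on_def)
    qed (use G_x r cd in auto)
    moreover have "(\<lambda>y. integral (cbox c r) (\<lambda>\<tau>. G \<tau> y)) = (\<lambda>y. F r y - F c y)"
      using FTC by (auto simp: integral_unique)
    moreover have "((\<lambda>y. F r y - F c y) has_real_derivative H r x - H c x) (at x)"
      using r cd by (intro DERIV_diff F_x) auto
    ultimately show ?thesis using DERIV_unique by fastforce
  qed
  have "continuous_on {c..d} (\<lambda>\<tau>. K \<tau> x)"
  proof -
    have "continuous_on {c..d} (\<lambda>\<tau>. (\<tau>, x))" "(\<lambda>\<tau>. (\<tau>, x)) ` {c..d} \<subseteq> {a<..<b} \<times> UNIV"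
      using cd by (auto intro!: continuous_on_Pair continuous_on_id continuous_on_const)
    then show ?thesis
      using continuous_on_compose2[OF K, of "{c..d}" "\<lambda>\<tau>. (\<tau>, x)"] by simp
  qed
  then have "((\<lambda>r. integral {c..r} (\<lambda>\<tau>. K \<tau> x)) has_real_derivative K t x) (at t within {c..d})"
    using cd by (intro integral_has_real_derivative) auto
  then have "((\<lambda>r. H c x + integral {c..r} (\<lambda>\<tau>. K \<tau> x)) has_real_derivative K t x) (at t)"
    using cd by (auto intro!: derivative_eq_intros simp: at_within_Icc_at)
  then show ?thesis
    by (rule has_field_derivative_transform_within_open[where S = "{c<..<d}"]) (use cd in \<open>auto simp: H_eq[symmetric]\<close>)
qed

section \<open>Time slices and partial derivatives in the time plane\<close>

lemma open_slice_fst: "open I \<Longrightarrow> open {\<tau>. (\<tau>, s) \<in> I}"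
  using open_vimage[of I "\<lambda>\<tau>. (\<tau>, s)"] by (simp add: vimage_def continuous_on_Pair)

lemma open_slice_snd: "open I \<Longrightarrow> open {\<sigma>. (t, \<sigma>) \<in> I}"
  using open_vimage[of I "\<lambda>\<sigma>. (t, \<sigma>)"] by (simp add: vimage_def continuous_on_Pair)

lemma derivative_eq_0_if_locally_0:
  assumes "open S" "t \<in> S" "\<And>\<tau>. \<tau> \<in> S \<Longrightarrow> h \<tau> = 0" "(h has_real_derivative d) (at t)"
  shows "d = 0"
proof -
  have "((\<lambda>_. 0) has_real_derivative d) (at t)"
    by (rule has_field_derivative_transform_within_open[OF assms(4,1,2)]) (use assms(3) in auto)
  then show ?thesis using DERIV_unique DERIV_const by blast
qed

lemma differentiable_has_real_derivative_fst:
  fixes g :: "real \<times> real \<Rightarrow> real"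
  assumes "g differentiable (at (t, s))"
  shows "((\<lambda>\<tau>. g (\<tau>, s)) has_real_derivative frechet_derivative g (at (t, s)) (1, 0)) (at t)"
  by (rule has_real_derivative_along_curve[OF assms has_vector_derivative_slice(1)])

lemma differentiable_has_real_derivative_snd:
  fixes g :: "real \<times> real \<Rightarrow> real"
  assumes "g differentiable (at (t, s))"
  shows "((\<lambda>\<sigma>. g (t, \<sigma>)) has_real_derivative frechet_derivative g (at (t, s)) (0, 1)) (at s)"
  by (rule has_real_derivative_along_curve[OF assms has_vector_derivative_slice(2)])

lemma has_real_derivative_Dt:
  assumes "g differentiable (at (t, s))"
  shows "((\<lambda>\<tau>. g (\<tau>, s)) has_real_derivative Dt g (t, s)) (at t)"
  using differentiable_has_real_derivative_fst[OF assms] by (simp add: Dt_def DERIV_imp_deriv)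

lemma has_real_derivative_Ds:
  assumes "g differentiable (at (t, s))"
  shows "((\<lambda>\<sigma>. g (t, \<sigma>)) has_real_derivative Ds g (t, s)) (at s)"
  using differentiable_has_real_derivative_snd[OF assms] by (simp add: Ds_def DERIV_imp_deriv)

text \<open>On \<open>I\<close> the slice derivative \<open>Dt g\<close> is the Frechet derivative
  in direction \<open>(1, 0)\<close>. Applied to \<open>f\<close>, this ensures that the second time
  derivative exists.\<close>

lemma smooth_on_Dt:
  assumes "open I" "smooth_on I g"
  shows "smooth_on I (Dt g)"
proof (rule smooth_on_cong[OF assms(1) _ smooth_on_frechet_derivative[OF assms(2), of "(1, 0)"]])
  fix p assume "p \<in> I"
  then have "g differentiable (at (fst p, snd p))"
    using smooth_on_differentiable[OF assms(2)] by simp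
  from differentiable_has_real_derivative_fst[OF this]
  show "frechet_derivative g (at p) (1, 0) = Dt g p"
    by (simp add: Dt_def DERIV_imp_deriv)
qed

subsection \<open>The boundary jet\<close>

lemma Dx_0: "Dx 0 v p x = v (p, x)"
  by (simp add: Dx_def)

lemma Dx_Suc: "Dx (Suc k) v p x = deriv (Dx k v p) x"
  unfolding Dx_def by simp

section \<open>Smoothness and time evolution of the spatial derivatives of \<open>v\<close>\<close>

context
  fixes I :: "(real \<times> real) set" and v :: "(real \<times> real) \<times> real \<Rightarrow> real"
  assumes open_I: "open I" and smooth_v: "smooth_on (I \<times> UNIV) v"
begin

lemma smooth_on_Dx: "smooth_on (I \<times> UNIV) (\<lambda>z. Dx k v (fst z) (snd z))"
proof (induction k)
  case 0
  then show ?case using smooth_v by (simp add: Dx_0)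
next
  case (Suc k)
  let ?V = "\<lambda>z. Dx k v (fst z) (snd z)"
  show ?case
  proof (rule smooth_on_cong[OF _ _ smooth_on_frechet_derivative[OF Suc, of "(0, 1)"]])
    fix z :: "(real \<times> real) \<times> real" assume z: "z \<in> I \<times> UNIV"
    obtain p x where px: "z = (p, x)" by fastforce
    have "((\<lambda>\<xi>. ?V (p, \<xi>)) has_real_derivative frechet_derivative ?V (at (p, x)) (0, 1)) (at x)"
      by (rule has_real_derivative_along_curve[of ?V "\<lambda>\<xi>. (p, \<xi>)"])
        (use smooth_on_differentiable[OF Suc z] px in \<open>auto intro!: has_vector_derivative_Pair_const has_vector_derivative_slice\<close>)
    then show "frechet_derivative ?V (at z) (0, 1) = Dx (Suc k) v (fst z) (snd z)"
      by (simp add: px Dx_def DERIV_imp_deriv)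
  qed (use open_I in \<open>auto intro: open_Times\<close>)
qed

lemma differentiable_Dx: "p \<in> I \<Longrightarrow> (\<lambda>z. Dx k v (fst z) (snd z)) differentiable (at (p, x))"
  by (rule smooth_on_differentiable[OF smooth_on_Dx]) simp

lemma has_real_derivative_Dx:
  assumes "p \<in> I"
  shows "(Dx k v p has_real_derivative Dx (Suc k) v p x) (at x)"
proof -
  have "((\<lambda>\<xi>. Dx k v (fst (p, \<xi>)) (snd (p, \<xi>))) has_real_derivative
      frechet_derivative (\<lambda>z. Dx k v (fst z) (snd z)) (at (p, x)) (0, 1)) (at x)"
    by (rule has_real_derivative_along_curve)
      (use differentiable_Dx[OF assms] in \<open>auto intro!: has_vector_derivative_Pair_const has_vector_derivative_slice\<close>)
  then have "((\<lambda>\<xi>. Dx k v p \<xi>) has_real_derivative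
      frechet_derivative (\<lambda>z. Dx k v (fst z) (snd z)) (at (p, x)) (0, 1)) (at x)"
    by simp
  moreover from this have "frechet_derivative (\<lambda>z. Dx k v (fst z) (snd z)) (at (p, x)) (0, 1) = Dx (Suc k) v p x"
    by (metis Dx_Suc DERIV_imp_deriv)
  ultimately show ?thesis by simp
qed

text \<open>All spatial derivatives of \<open>v\<close> inherit the heat equation: the induction
  step differentiates it in x and exchanges the derivatives by
  \<open>mixed_partial_derivative\<close>.\<close>

lemma has_real_derivative_time_Dx:
  assumes heat: "\<And>t s x. (t, s) \<in> I \<Longrightarrow> Dt (\<lambda>p. v (p, x)) (t, s) = 1 / 2 * Dx 2 v (t, s) x"
    and "(t, s) \<in> I"
  shows "((\<lambda>\<tau>. Dx k v (\<tau>, s) x) has_real_derivative 1 / 2 * Dx (k + 2) v (t, s) x) (at t)"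
  using assms(2)
proof (induction k arbitrary: t x)
  case 0
  have "((\<lambda>\<tau>. v ((\<tau>, s), x)) has_real_derivative frechet_derivative v (at ((t, s), x)) ((1, 0), 0)) (at t)"
    by (rule has_real_derivative_along_curve[of v "\<lambda>\<tau>. ((\<tau>, s), x)"])
      (use smooth_on_differentiable[OF smooth_v, of "((t, s), x)"] 0
        in \<open>auto intro!: has_vector_derivative_Pair_const has_vector_derivative_slice\<close>)
  \<comment> \<open>The heat equation fixes only the value of \<open>deriv\<close>; existence of the
    derivative comes from smoothness of \<open>v\<close>.\<close>
  moreover from this have "frechet_derivative v (at ((t, s), x)) ((1, 0), 0) = 1 / 2 * Dx 2 v (t, s) x"
    using heat[OF 0, of x] by (simp add: Dt_def DERIV_imp_deriv)
  ultimately show ?case by (simp add: Dx_0 numeral_2_eq_2)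
next
  case (Suc k)
  \<comment> \<open>The exchange of derivatives works on a strip, so an interval of times inside the
    slice of \<open>I\<close> is chosen.\<close>
  obtain e where "e > 0" and e: "\<And>\<tau>. dist \<tau> t < e \<Longrightarrow> (\<tau>, s) \<in> I"
    using open_slice_fst[OF open_I, of s] Suc.prems unfolding open_dist by blast
  have slice: "(\<tau>, s) \<in> I" if "\<tau> \<in> {t - e<..<t + e}" for \<tau>
    using that by (intro e) (auto simp: dist_real_def)
  let ?S = "{t - e<..<t + e} \<times> (UNIV :: real set)"
  have "continuous_on ?S (\<lambda>z. ((fst z, s), snd z))"
    by (intro continuous_on_Pair continuous_on_fst continuous_on_snd continuous_on_const continuous_on_id)
  moreover have "(\<lambda>z. ((fst z, s), snd z)) ` ?S \<subseteq> I \<times> UNIV"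
    using slice by auto
  ultimately have "continuous_on ?S (\<lambda>z. Dx (Suc k + 2) v (fst z, s) (snd z))"
    using continuous_on_compose2[OF smooth_on_continuous[OF smooth_on_Dx[of "Suc k + 2"]],
        of ?S "\<lambda>z. ((fst z, s), snd z)"] by simp
  then have cont: "continuous_on ?S (\<lambda>(\<tau>, y). 1 / 2 * Dx (Suc k + 2) v (\<tau>, s) y)"
    unfolding case_prod_unfold by (rule continuous_on_mult_left)
  show ?case
  proof (rule mixed_partial_derivative[where F = "\<lambda>\<tau>. Dx k v (\<tau>, s)"
        and G = "\<lambda>\<tau> y. 1 / 2 * Dx (k + 2) v (\<tau>, s) y"
        and a = "t - e" and b = "t + e", OF _ _ _ _ cont])
    fix \<tau> y assume "\<tau> \<in> {t - e<..<t + e}"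
    then have \<tau>: "(\<tau>, s) \<in> I" by (rule slice)
    show "((\<lambda>\<tau>. Dx k v (\<tau>, s) y) has_real_derivative 1 / 2 * Dx (k + 2) v (\<tau>, s) y) (at \<tau>)"
      by (rule Suc.IH[OF \<tau>])
    show "(Dx k v (\<tau>, s) has_real_derivative Dx (Suc k) v (\<tau>, s) y) (at y)"
      by (rule has_real_derivative_Dx[OF \<tau>])
    show "((\<lambda>y. 1 / 2 * Dx (k + 2) v (\<tau>, s) y) has_real_derivative
        1 / 2 * Dx (Suc k + 2) v (\<tau>, s) y) (at y)"
      using has_real_derivative_Dx[OF \<tau>, of "k + 2"] by (intro DERIV_cmult) simp
  qed (use \<open>e > 0\<close> in auto)
qed

section \<open>Differentiating along the moving zero x = f(t, s)\<close>

context
  fixes f :: "real \<times> real \<Rightarrow> real" and t s :: real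
  assumes smooth_f: "smooth_on I f"
    and heat: "\<And>t s x. (t, s) \<in> I \<Longrightarrow> Dt (\<lambda>p. v (p, x)) (t, s) = 1 / 2 * Dx 2 v (t, s) x"
    and boundary: "\<And>t s. (t, s) \<in> I \<Longrightarrow> v ((t, s), f (t, s)) = 0"
    and ts: "(t, s) \<in> I"
begin

text \<open>Chain rule along the boundary, with the time derivative replaced through the heat
  equation. The cases k = 0, 1, 2 produce the second and fourth rows of \<open>M2\<close>.\<close>

lemma has_real_derivative_Dx_boundary:
  "((\<lambda>\<tau>. Dx k v (\<tau>, s) (f (\<tau>, s))) has_real_derivative
     1 / 2 * Dx (k + 2) v (t, s) (f (t, s)) + Dt f (t, s) * Dx (k + 1) v (t, s) (f (t, s))) (at t)"
proof -
  note D = has_real_derivative_along_graph[of "\<lambda>z. Dx k v (fst z) (snd z)" "\<lambda>\<tau>. (\<tau>, s)" t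
      "\<lambda>\<tau>. f (\<tau>, s)", OF differentiable_Dx[OF ts] has_vector_derivative_slice(1)
      has_real_derivative_Dt[OF smooth_on_differentiable[OF smooth_f ts]], unfolded fst_conv snd_conv]
  show ?thesis
    using D[OF has_real_derivative_time_Dx[OF heat ts] has_real_derivative_Dx[OF ts]] by simp
qed

lemma boundary_heat:
  "Dx 2 v (t, s) (f (t, s)) + 2 * Dt f (t, s) * Dx 1 v (t, s) (f (t, s)) = 0"
proof -
  have "1 / 2 * Dx (0 + 2) v (t, s) (f (t, s)) + Dt f (t, s) * Dx (0 + 1) v (t, s) (f (t, s)) = 0"
    by (rule derivative_eq_0_if_locally_0[OF open_slice_fst[OF open_I, of s] _ _
          has_real_derivative_Dx_boundary[of 0]]) (use ts boundary in \<open>auto simp: Dx_0\<close>)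
  then show ?thesis by (simp add: field_simps numeral_2_eq_2)
qed

lemma boundary_airy:
  assumes airy: "Ds (\<lambda>p. v (p, f (t, s))) (t, s) = - 1 / 3 * Dx 3 v (t, s) (f (t, s))"
  shows "Dx 3 v (t, s) (f (t, s)) - 3 * Ds f (t, s) * Dx 1 v (t, s) (f (t, s)) = 0"
proof -
  let ?x = "f (t, s)"
  have v: "v differentiable (at ((t, s), ?x))"
    using smooth_on_differentiable[OF smooth_v, of "((t, s), ?x)"] ts by simp
  have "((\<lambda>\<sigma>. v ((t, \<sigma>), ?x)) has_real_derivative frechet_derivative v (at ((t, s), ?x)) ((0, 1), 0)) (at s)"
    by (rule has_real_derivative_along_curve[of v "\<lambda>\<sigma>. ((t, \<sigma>), ?x)"])
      (use v in \<open>auto intro!: has_vector_derivative_Pair_const has_vector_derivative_slice\<close>)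
  then have "((\<lambda>\<sigma>. v ((t, \<sigma>), ?x)) has_real_derivative - 1 / 3 * Dx 3 v (t, s) ?x) (at s)"
    using airy by (simp add: Ds_def DERIV_imp_deriv)
  moreover have "((\<lambda>\<xi>. v ((t, s), \<xi>)) has_real_derivative Dx 1 v (t, s) ?x) (at ?x)"
    using has_real_derivative_Dx[OF ts, of 0] by (simp add: Dx_0[abs_def])
  ultimately have "((\<lambda>\<sigma>. v ((t, \<sigma>), f (t, \<sigma>))) has_real_derivative
      - 1 / 3 * Dx 3 v (t, s) ?x + Ds f (t, s) * Dx 1 v (t, s) ?x) (at s)"
    by (rule has_real_derivative_along_graph[of v "\<lambda>\<sigma>. (t, \<sigma>)" s "\<lambda>\<sigma>. f (t, \<sigma>)" "(0, 1)", OF v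
        has_vector_derivative_slice(2)
        has_real_derivative_Ds[OF smooth_on_differentiable[OF smooth_f ts]]])
  from derivative_eq_0_if_locally_0[OF open_slice_snd[OF open_I] _ _ this] ts boundary
  show ?thesis by (auto simp: field_simps)
qed

end

text \<open>This is twice the t-derivative of the identity in \<open>boundary_heat\<close>. That
  identity is needed at all nearby times, hence the place outside the context with a fixed point
  \<open>(t, s)\<close>.\<close>

lemma boundary_heat_twice:
  assumes smooth_f: "smooth_on I f"
    and heat: "\<And>t s x. (t, s) \<in> I \<Longrightarrow> Dt (\<lambda>p. v (p, x)) (t, s) = 1 / 2 * Dx 2 v (t, s) x"
    and boundary: "\<And>t s. (t, s) \<in> I \<Longrightarrow> v ((t, s), f (t, s)) = 0"
    and ts: "(t, s) \<in> I"
  shows "Dx 4 v (t, s) (f (t, s)) + 4 * Dt f (t, s) * Dx 3 v (t, s) (f (t, s))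
    + 4 * (Dt f (t, s))\<^sup>2 * Dx 2 v (t, s) (f (t, s)) + 4 * Dt (Dt f) (t, s) * Dx 1 v (t, s) (f (t, s)) = 0"
proof -
  let ?V = "\<lambda>k. Dx k v (t, s) (f (t, s))"
  have D: "((\<lambda>\<tau>. Dx k v (\<tau>, s) (f (\<tau>, s))) has_real_derivative
      1 / 2 * ?V (k + 2) + Dt f (t, s) * ?V (k + 1)) (at t)" for k
    by (rule has_real_derivative_Dx_boundary[OF smooth_f heat boundary ts])
  have "((\<lambda>\<tau>. 2 * Dt f (\<tau>, s)) has_real_derivative 2 * Dt (Dt f) (t, s)) (at t)"
    by (intro DERIV_cmult has_real_derivative_Dt smooth_on_differentiable[OF _ ts]
        smooth_on_Dt open_I smooth_f)
  moreover have "((\<lambda>\<tau>. Dx 1 v (\<tau>, s) (f (\<tau>, s))) has_real_derivative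
      1 / 2 * ?V 3 + Dt f (t, s) * ?V 2) (at t)"
    using D[of 1] by (simp add: eval_nat_numeral)
  moreover have "((\<lambda>\<tau>. Dx 2 v (\<tau>, s) (f (\<tau>, s))) has_real_derivative
      1 / 2 * ?V 4 + Dt f (t, s) * ?V 3) (at t)"
    using D[of 2] by (simp add: eval_nat_numeral)
  ultimately have "((\<lambda>\<tau>. Dx 2 v (\<tau>, s) (f (\<tau>, s)) + 2 * Dt f (\<tau>, s) * Dx 1 v (\<tau>, s) (f (\<tau>, s)))
      has_real_derivative 1 / 2 * ?V 4 + Dt f (t, s) * ?V 3 + (2 * Dt (Dt f) (t, s) * ?V 1 +
      (1 / 2 * ?V 3 + Dt f (t, s) * ?V 2) * (2 * Dt f (t, s)))) (at t)"
    by (intro DERIV_add DERIV_mult)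
  then have "1 / 2 * ?V 4 + Dt f (t, s) * ?V 3 + (2 * Dt (Dt f) (t, s) * ?V 1 +
      (1 / 2 * ?V 3 + Dt f (t, s) * ?V 2) * (2 * Dt f (t, s))) = 0"
    by (rule derivative_eq_0_if_locally_0[OF open_slice_fst[OF open_I, of s], rotated 2])
      (use ts boundary_heat[OF smooth_f heat boundary] in \<open>simp_all del: One_nat_def\<close>)
  then show ?thesis by (simp add: algebra_simps power2_eq_square)
qed

end

theorem mainTheorem3:
  fixes c :: "nat \<Rightarrow> nat \<Rightarrow> real"
    and I :: "(real \<times> real) set"
    and f :: "real \<times> real \<Rightarrow> real"
    and v :: "(real \<times> real) \<times> real \<Rightarrow> real"
  assumes "open I"
    and "smooth_on I f"
    and "smooth_on (I \<times> UNIV) v"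
    and "\<And>t s x. (t, s) \<in> I \<Longrightarrow> Dt (\<lambda>p. v (p, x)) (t, s) = 1 / 2 * Dx 2 v (t, s) x"
    and "\<And>t s x. (t, s) \<in> I \<Longrightarrow> Ds (\<lambda>p. v (p, x)) (t, s) = - 1 / 3 * Dx 3 v (t, s) x"
    and "\<And>t s x. (t, s) \<in> I \<Longrightarrow> N2 c t s (\<lambda>\<xi>. v ((t, s), \<xi>)) x = 0"
    and "\<And>t s. (t, s) \<in> I \<Longrightarrow> v ((t, s), f (t, s)) = 0"
  shows "(\<forall>t s. bij (heat_airy t s) \<and>
            (\<forall>p. poly ((heat_airy t s \<circ> L2 c \<circ> inv (heat_airy t s)) p) = N2 c t s (poly p))) \<and>
         (\<forall>t s. (t, s) \<in> I \<longrightarrow>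
            M2 c f t s *v V2 v (t, s) (f (t, s)) = 0 \<and>
            (V2 v (t, s) (f (t, s)) \<noteq> 0 \<longrightarrow> det (M2 c f t s) = 0) \<and>
            (det (M2 c f t s) = 0 \<longleftrightarrow>
               q c 1 (f (t, s)) t s - 2 * Dt f (t, s) * q c 2 (f (t, s)) t s
               + 3 * Ds f (t, s) * q c 3 (f (t, s)) t s
               + (- 4 * Dt (Dt f) (t, s) + 8 * (Dt f (t, s)) ^ 3
                  - 12 * Dt f (t, s) * Ds f (t, s)) * q c 4 (f (t, s)) t s = 0))"
proof (intro conjI allI impI)
  fix t s :: real and p :: "real poly"
  show "bij (heat_airy t s)"
    by (rule bij_heat_airy)
  show "poly ((heat_airy t s \<circ> L2 c \<circ> inv (heat_airy t s)) p) = N2 c t s (poly p)"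
    by (rule heat_airy_conj_L2)
next
  fix t s :: real assume ts: "(t, s) \<in> I"
  let ?x = "f (t, s)"
  \<comment> \<open>At the boundary the order-zero term of \<open>N2\<close> vanishes, leaving the
    four derivatives collected in \<open>V2\<close>.\<close>
  have v0: "Dx 0 v (t, s) ?x = 0"
    using assms(7)[OF ts] by (simp add: Dx_0)
  have "N2 c t s (\<lambda>\<xi>. v ((t, s), \<xi>)) ?x = (\<Sum>k\<le>4. q c k ?x t s * Dx k v (t, s) ?x)"
    by (simp add: N2_def Dx_def)
  also have "\<dots> = q c 4 ?x t s * Dx 4 v (t, s) ?x + q c 3 ?x t s * Dx 3 v (t, s) ?x
      + q c 2 ?x t s * Dx 2 v (t, s) ?x + q c 1 ?x t s * Dx 1 v (t, s) ?x"
    using v0 by (simp add: eval_nat_numeral)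
  finally have N2: "\<dots> = 0"
    using assms(6)[OF ts] by simp
  \<comment> \<open>The four rows are, in order, the restricted equation for \<open>N2\<close>, the
    t-derivative, the s-derivative and the second t-derivative of the boundary condition.\<close>
  show M2: "M2 c f t s *v V2 v (t, s) ?x = 0"
    unfolding M2_kernel_iff V2_def vector_4
    by (intro conjI N2 boundary_heat[OF assms(1,3,2,4,7) ts]
        boundary_airy[OF assms(1,3,2,4,7) ts assms(5)[OF ts]]
        boundary_heat_twice[OF assms(1,3,2,4,7) ts])
  show "det (M2 c f t s) = 0" if "V2 v (t, s) ?x \<noteq> 0"
    using M2 that by (auto simp: det_eq_0_iff_kernel)
qed (rule det_M2_eq_0_iff)

end
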